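(* Let $m\ge 2$, let $n$ be a positive odd integer, and let $u(x)$ be a parity-check idempotent over $\mathrm{GF}(2^m)$ of length $n$. Let $\mathcal{C}\neq\{0\}$ be the cyclic code of length $n$ over $\mathrm{GF}(2^m)$ defined by $u(x)$, let $g(x)$ be its generator polynomial, and let $d_{min}$ be its minimum Hamming distance. Let $U(z)=\mathrm{MS}(u(x))$ be the Mattson-Solomon polynomial of $u(x)$, and let $d_0$ denote the maximum length of a run of consecutive coefficients equal to $1$ in $U(z)$, with coefficient positions taken cyclically modulo $n$. Then $$d_0 < d_{min} \le \min\left(wt(g(x)),\, 1+wt(u(x))\right).$$
   Context: Setting. Let $m,m'$ be positive integers with $m\mid m'$, let $n$ be a positive odd integer, and let $\mathrm{GF}(2^{m'})$ be the splitting field of $1+x^n$ over $\mathrm{GF}(2^m)$, so $n\mid 2^{m'}-1$. Put $r=(2^{m'}-1)/n$ and $l=(2^{m'}-1)/(2^m-1)$. Let $\alpha$ be a generator of the multiplicative group of $\mathrm{GF}(2^{m'})$ and $\beta=\alpha^l$ a generator of the multiplicative group of $\mathrm{GF}(2^m)$. Let $T_a(x)$ be the set of polynomials of degree at most $n-1$ with coefficients in $\mathrm{GF}(2^a)$. The weight $wt(f(x))$ is the number of nonzero coefficients of $f(x)$. Mattson-Solomon polynomial. For $a(x)\in T_{m'}(x)$, $\mathrm{MS}(a(x))=\sum_{j=0}^{n-1}a(\alpha^{-rj})z^j$. If $e(x)\in T_m(x)$ is an idempotent, i.e. $e(x)^2\equiv e(x) \pmod{1+x^n}$, then all coefficients of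 $\mathrm{MS}(e(x))$ lie in $\{0,1\}$. Cyclotomic cosets. The binary cyclotomic coset of $s$ modulo $n$ is $C_s=\{2^i s \bmod n : i\ge 0\}$, indexed by its smallest element $s$; its elements are listed as $C_{s,i}=2^i s \bmod n$, $0\le i\le |C_s|-1$. Let $\mathcal{N}$ be the set of smallest elements of all the cosets; the cosets $C_s$, $s\in\mathcal{N}$, partition $\{0,1,\ldots,n-1\}$. Parity-check idempotent. For $s\in\mathcal{N}$, a cyclotomic idempotent is a polynomial $e_s(x)=\sum_{0\le i\le |C_s|-1}e_{C_{s,i}}x^{C_{s,i}}\in T_m(x)$ with $e_{C_{s,0}}\in\{1,\beta,\ldots,\beta^{2^m-2}\}$ and $e_{C_{s,i}}=e_{C_{s,i-1}}^2$ for $i>0$, where $e_{C_{s,0}}$ is such that $e_s(x)$ is an idempotent. A parity-check idempotent is $u(x)=\sum_{s\in\mathcal{M}}e_s(x)$ for some $\mathcal{M}\subseteq\mathcal{N}$ and some choice of such $e_s(x)$; it is an idempotent in $T_m(x)$. The code. The cyclic code $\mathcal{C}$ defined by $u(x)$ is the linear code of length $n$ over $\mathrm{GF}(2^m)$ whose parity-check matrix has as rows the $n$ cyclic shifts of the coefficient vector of $x^{\deg u(x)}u(x^{-1})$; equivalently, identifying vectors with polynomials modulo $1+x^n$, $\mathcal{C}=\{c(x)\in T_m(x): c(x)u(x)\equiv 0 \pmod{1+x^n}\}$. With $h(x)=\gcd(u(x),1+x^n)$ (monic), its generator polynomial is $g(x)=(1+x^n)/h(x)$. *)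

theory Defs
  imports
    "HOL-Computational_Algebra.Polynomial"
    "HOL-Number_Theory.Cong"
    "HOL-Library.Cardinality"
    "Jordan_Normal_Form.Matrix"
begin

hide_const (open) Module.smult

text \<open>
  The large field \<open>GF(2^m')\<close> is a type \<open>'a\<close> of class \<open>{field, finite}\<close>, and
  \<open>GF(2^m)\<close> is a subfield \<open>K\<close> of it, given as a set.
\<close>

subsection \<open>Fields\<close>

definition is_subfield :: "'a::field set \<Rightarrow> bool" where
  "is_subfield F \<longleftrightarrow> 0 \<in> F \<and> 1 \<in> F \<and>
     (\<forall>x\<in>F. \<forall>y\<in>F. x + y \<in> F \<and> x * y \<in> F) \<and>
     (\<forall>x\<in>F. - x \<in> F \<and> inverse x \<in> F)"

definition splits_in :: "'a::field set \<Rightarrow> 'a poly \<Rightarrow> bool" where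
  "splits_in F p \<longleftrightarrow>
     (\<exists>c\<in>F. \<exists>A. set_mset A \<subseteq> F \<and> p = smult c (\<Prod>a\<in>#A. [:- a, 1:]))"

definition type_is_splitting_field :: "'a::field set \<Rightarrow> 'a poly \<Rightarrow> bool" where
  "type_is_splitting_field K p \<longleftrightarrow> splits_in UNIV p \<and>
     (\<forall>F. is_subfield F \<and> K \<subseteq> F \<and> splits_in F p \<longrightarrow> F = UNIV)"

definition mult_generator :: "'a::field \<Rightarrow> bool" where
  "mult_generator a \<longleftrightarrow> range (\<lambda>k::nat. a ^ k) = UNIV - {0}"

subsection \<open>Polynomials\<close>

definition xn1 :: "nat \<Rightarrow> 'a::field poly" where
  "xn1 n = 1 + monom 1 n"

definition T :: "'a::field set \<Rightarrow> nat \<Rightarrow> 'a poly set" where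
  "T K n = {f. degree f \<le> n - 1 \<and> range (coeff f) \<subseteq> K}"

definition wt :: "'a::zero poly \<Rightarrow> nat" where
  "wt f = card {i. coeff f i \<noteq> 0}"

definition idempotent :: "nat \<Rightarrow> 'a::field poly \<Rightarrow> bool" where
  "idempotent n e \<longleftrightarrow> [e\<^sup>2 = e] (mod xn1 n)"

text \<open>The library \<open>gcd\<close> on polynomials is not available over an arbitrary type of class
  \<open>field\<close>.\<close>

definition is_monic_gcd :: "'a::field poly \<Rightarrow> 'a poly \<Rightarrow> 'a poly \<Rightarrow> bool" where
  "is_monic_gcd h p q \<longleftrightarrow> lead_coeff h = 1 \<and> h dvd p \<and> h dvd q \<and>
     (\<forall>d. d dvd p \<and> d dvd q \<longrightarrow> d dvd h)"

definition monic_gcd :: "'a::field poly \<Rightarrow> 'a poly \<Rightarrow> 'a poly" where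
  "monic_gcd p q = (THE h. is_monic_gcd h p q)"

subsection \<open>Mattson-Solomon polynomial\<close>

definition MS :: "'a::field \<Rightarrow> nat \<Rightarrow> nat \<Rightarrow> 'a poly \<Rightarrow> 'a poly" where
  "MS \<alpha> r n a = (\<Sum>j<n. monom (poly a (inverse \<alpha> ^ (r * j))) j)"

text \<open>A run has length at most \<open>n\<close>, and length 0 if no coefficient is 1.\<close>

definition max_cyclic_run :: "nat \<Rightarrow> 'a::field poly \<Rightarrow> nat" where
  "max_cyclic_run n U =
     Max {k. k \<le> n \<and> (\<exists>j<n. \<forall>i<k. coeff U ((j + i) mod n) = 1)}"

subsection \<open>Cyclotomic cosets and parity-check idempotents\<close>

definition cyc_coset :: "nat \<Rightarrow> nat \<Rightarrow> nat set" where
  "cyc_coset n s = range (\<lambda>i. 2 ^ i * s mod n)"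

definition coset_reps :: "nat \<Rightarrow> nat set" where
  "coset_reps n = (\<lambda>s. Min (cyc_coset n s)) ` {..<n}"

text \<open>\<open>c i\<close> is the coefficient of \<open>e\<close> at the \<open>i\<close>-th element of the coset of \<open>s\<close>.\<close>

definition cyclotomic_idempotent ::
  "'a::field set \<Rightarrow> nat \<Rightarrow> nat \<Rightarrow> 'a \<Rightarrow> nat \<Rightarrow> 'a poly \<Rightarrow> bool" where
  "cyclotomic_idempotent K m n \<beta> s e \<longleftrightarrow>
     (\<exists>c :: nat \<Rightarrow> 'a.
        c 0 \<in> {\<beta> ^ k |k. k \<le> 2 ^ m - 2} \<and>
        (\<forall>i. 0 < i \<and> i < card (cyc_coset n s) \<longrightarrow> c i = (c (i - 1))\<^sup>2) \<and>
        e = (\<Sum>i<card (cyc_coset n s). monom (c i) (2 ^ i * s mod n))) \<and>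
     e \<in> T K n \<and> idempotent n e"

definition parity_check_idempotent ::
  "'a::field set \<Rightarrow> nat \<Rightarrow> nat \<Rightarrow> 'a \<Rightarrow> 'a poly \<Rightarrow> bool" where
  "parity_check_idempotent K m n \<beta> u \<longleftrightarrow>
     (\<exists>M e. M \<subseteq> coset_reps n \<and> (\<forall>s\<in>M. cyclotomic_idempotent K m n \<beta> s (e s)) \<and>
        u = (\<Sum>s\<in>M. e s))"

subsection \<open>The code\<close>

text \<open>\<open>reflect_poly u\<close> is \<open>x^(deg u) * u(1/x)\<close>; row \<open>k\<close> is its coefficient vector cyclically
  shifted \<open>k\<close> places to the right. Codewords are represented by their polynomials.\<close>

definition parity_check_matrix :: "nat \<Rightarrow> 'a::field poly \<Rightarrow> 'a mat" where
  "parity_check_matrix n u = mat n n (\<lambda>(k, i). coeff (reflect_poly u) ((i + n - k) mod n))"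

definition cyclic_code :: "'a::field set \<Rightarrow> nat \<Rightarrow> 'a poly \<Rightarrow> 'a poly set" where
  "cyclic_code K n u = {c \<in> T K n. parity_check_matrix n u *\<^sub>v vec n (coeff c) = 0\<^sub>v n}"

definition generator_poly :: "nat \<Rightarrow> 'a::field poly \<Rightarrow> 'a poly" where
  "generator_poly n u = xn1 n div monic_gcd u (xn1 n)"

definition hamming_dist :: "'a::zero poly \<Rightarrow> 'a poly \<Rightarrow> nat" where
  "hamming_dist c c' = card {i. coeff c i \<noteq> coeff c' i}"

definition min_dist :: "'a::zero poly set \<Rightarrow> nat" where
  "min_dist C = Inf {hamming_dist c c' |c c'. c \<in> C \<and> c' \<in> C \<and> c \<noteq> c'}"

subsection \<open>Sanity of the definitions\<close>

lemma monic_gcd_exists: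
  fixes p q :: "'a::field poly"
  assumes "p \<noteq> 0 \<or> q \<noteq> 0"
  shows "\<exists>h. is_monic_gcd h p q"
proof -
  define I where "I = {a * p + b * q |a b. True}"
  have pI: "p \<in> I" unfolding I_def by (rule CollectI, rule exI[of _ 1], rule exI[of _ 0]) simp
  have qI: "q \<in> I" unfolding I_def by (rule CollectI, rule exI[of _ 0], rule exI[of _ 1]) simp
  have "\<exists>g. g \<in> I \<and> g \<noteq> 0" using assms pI qI by blast
  then obtain g where g: "g \<in> I" "g \<noteq> 0"
    and min: "\<And>f. f \<in> I \<Longrightarrow> f \<noteq> 0 \<Longrightarrow> degree g \<le> degree f"
    using ex_has_least_nat[of "\<lambda>g. g \<in> I \<and> g \<noteq> 0" _ degree] by blast
  obtain a b where ab: "g = a * p + b * q" using g(1) unfolding I_def by blast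
  have dv: "g dvd f" if fI: "f \<in> I" for f
  proof -
    obtain a' b' where f: "f = a' * p + b' * q" using fI unfolding I_def by blast
    have "f mod g = f - f div g * g" by (simp add: minus_div_mult_eq_mod)
    also have "\<dots> = (a' - f div g * a) * p + (b' - f div g * b) * q"
      by (subst (2) ab, subst (1) f) (simp add: algebra_simps)
    finally have "f mod g \<in> I" unfolding I_def by blast
    then have "f mod g = 0"
      using min[of "f mod g"] degree_mod_less[OF g(2), of f] by linarith
    then show ?thesis by blast
  qed
  define h where "h = smult (inverse (lead_coeff g)) g"
  have "lead_coeff h = 1" using g(2) by (simp add: h_def)
  moreover have "h dvd p" "h dvd q"
    using dv[OF pI] dv[OF qI] g(2) by (simp_all add: h_def smult_dvd)
  moreover have "d dvd h" if "d dvd p" "d dvd q" for d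
    unfolding h_def ab by (intro dvd_smult dvd_add dvd_mult that)
  ultimately show ?thesis unfolding is_monic_gcd_def by blast
qed

lemma is_monic_gcd_monic_gcd:
  fixes p q :: "'a::field poly"
  assumes "p \<noteq> 0 \<or> q \<noteq> 0"
  shows "is_monic_gcd (monic_gcd p q) p q"
  unfolding monic_gcd_def
proof (rule theI')
  have "h = h'" if "is_monic_gcd h p q" "is_monic_gcd h' p q" for h h'
  proof -
    have hh: "h dvd h'" "h' dvd h" "lead_coeff h = 1" "lead_coeff h' = 1"
      using that unfolding is_monic_gcd_def by auto
    from hh(1) obtain k where k: "h' = h * k" by auto
    have deg: "degree h' = degree h"
      using hh by (metis dvd_imp_degree_le le_antisym leading_coeff_0_iff one_neq_zero)
    have "degree k = 0"
      using k hh deg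
      by (metis add_cancel_left_right degree_mult_eq leading_coeff_0_iff mult_zero_right zero_neq_one)
    moreover have "lead_coeff k = 1" using k hh by (simp add: lead_coeff_mult)
    ultimately have "k = 1" by (auto elim!: degree_eq_zeroE)
    then show ?thesis using k by simp
  qed
  then show "\<exists>!h. is_monic_gcd h p q" using monic_gcd_exists[OF assms] by blast
qed

lemma mult_mod_cong:
  fixes c u :: "'a::field poly"
  assumes two: "(1 :: 'a) + 1 = 0" and n: "n > 0"
    and c: "degree c < n" and u: "degree u < n"
  shows "[c * u = (\<Sum>i<n. \<Sum>j<n. monom (coeff c i * coeff u j) ((i + j) mod n))] (mod xn1 n)"
proof -
  have m1: "- (1::'a) = 1" using two by (metis add_eq_0_iff)
  have sm: "p = (\<Sum>i<n. monom (coeff p i) i)" if "degree p < n" for p :: "'a poly"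
  proof (rule poly_eqI)
    fix k
    show "coeff p k = coeff (\<Sum>i<n. monom (coeff p i) i) k"
      using that by (simp add: coeff_sum coeff_eq_0)
  qed
  have "xn1 n = monom 1 n - (1 :: 'a poly)"
  proof -
    have "(1::'a poly) = - 1" using m1 by (metis minus_pCons neg_0_equal_iff_equal one_pCons)
    then show ?thesis by (simp add: xn1_def)
  qed
  then have one: "[monom 1 n = (1 :: 'a poly)] (mod xn1 n)" by (simp add: cong_iff_dvd_diff)
  have mm: "[monom a k = monom a (k mod n)] (mod xn1 n)" for a :: 'a and k
  proof -
    have "monom a k = monom a (k mod n) * (monom 1 n) ^ (k div n)"
      by (simp add: monom_power mult_monom mult.commute)
    moreover have "[monom a (k mod n) * (monom 1 n) ^ (k div n) = monom a (k mod n) * 1 ^ (k div n)]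
        (mod xn1 n)"
      by (intro cong_mult cong_pow one cong_refl)
    ultimately show ?thesis by simp
  qed
  have "c * u = (\<Sum>i<n. \<Sum>j<n. monom (coeff c i * coeff u j) (i + j))"
    by (subst sm[OF c], subst sm[OF u]) (simp add: sum_product mult_monom)
  then show ?thesis by (simp only:) (intro cong_sum mm)
qed

text \<open>The description of the code by polynomial multiplication modulo \<open>1 + x^n\<close>.\<close>

lemma cyclic_code_eq:
  fixes u :: "'a::field poly"
  assumes two: "(1 :: 'a) + 1 = 0" and n: "n > 0" and u: "degree u < n"
  shows "cyclic_code K n u = {c \<in> T K n. [c * u = 0] (mod xn1 n)}"
proof -
  have "parity_check_matrix n u *\<^sub>v vec n (coeff c) = 0\<^sub>v n \<longleftrightarrow> [c * u = 0] (mod xn1 n)"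
    if "c \<in> T K n" for c
  proof -
    define d where "d = degree u"
    have c: "degree c < n" using that n by (auto simp: T_def)
    define F where "F = (\<Sum>i<n. \<Sum>j<n. monom (coeff c i * coeff u j) ((i + j) mod n))"
    have F0: "coeff F t = 0" if "t \<ge> n" for t
    proof -
      have "(i + j) mod n \<noteq> t" for i j using that n by (metis mod_less_divisor not_le)
      then show ?thesis by (simp add: F_def coeff_sum)
    qed
    have idx: "(i + j) mod n = t \<longleftrightarrow> j = (t + n - i) mod n" if "i < n" "j < n" "t < n" for i j t
    proof -
      have "(i + j) mod n = (if i + j < n then i + j else i + j - n)"
        using that by (simp add: mod_if)
      moreover have "(t + n - i) mod n = (if t < i then t + n - i else t - i)"
        using that by (auto simp: mod_if)
      ultimately show ?thesis using that by auto
    qed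
    have Ft: "coeff F t = (\<Sum>i<n. coeff c i * coeff u ((t + n - i) mod n))" if "t < n" for t
    proof -
      have "coeff F t =
          (\<Sum>i<n. \<Sum>j<n. if (i + j) mod n = t then coeff c i * coeff u j else 0)"
        by (simp add: F_def coeff_sum)
      also have "\<dots> =
          (\<Sum>i<n. \<Sum>j<n. if j = (t + n - i) mod n then coeff c i * coeff u j else 0)"
        using that by (intro sum.cong refl) (simp add: idx)
      also have "\<dots> = (\<Sum>i<n. coeff c i * coeff u ((t + n - i) mod n))"
        using n by (simp add: sum.delta')
      finally show ?thesis .
    qed
    have row: "(\<Sum>i<n. coeff (reflect_poly u) ((i + n - k) mod n) * coeff c i)
        = coeff F ((d + k) mod n)" if k: "k < n" for k
    proof -
      have "coeff (reflect_poly u) ((i + n - k) mod n) = coeff u (((d + k) mod n + n - i) mod n)"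
        if i: "i < n" for i
      proof -
        define j where "j = (i + n - k) mod n"
        have j: "j = (if i < k then i + n - k else i - k)"
          using i k by (auto simp: j_def mod_if)
        have dk: "(d + k) mod n = (if d + k < n then d + k else d + k - n)"
          using k u by (simp add: mod_if d_def)
        have jn: "j < n" using n by (simp add: j_def)
        have "((d + k) mod n + n - i) mod n = (if j \<le> d then d - j else d + n - j)"
        proof -
          have "(t + n - i) mod n = (if t < i then t + n - i else t - i)"
            if "t < n" for t using i that by (auto simp: mod_if)
          then have "((d + k) mod n + n - i) mod n =
              (if (d + k) mod n < i then (d + k) mod n + n - i else (d + k) mod n - i)"
            using n by simp
          also have "\<dots> = (if j \<le> d then d - j else d + n - j)"
            unfolding j dk using i k u[folded d_def] by (auto split: if_splits)
          finally show ?thesis .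
        qed
        moreover have "coeff u (d + n - j) = 0" if "d < j"
          using jn by (intro coeff_eq_0) (simp add: d_def)
        ultimately show ?thesis
          unfolding j_def[symmetric] coeff_reflect_poly d_def by auto
      qed
      then show ?thesis using n by (subst Ft) (auto intro!: sum.cong)
    qed
    have surj: "\<exists>k<n. t = (d + k) mod n" if "t < n" for t
    proof (intro exI conjI)
      show "(t + n - d) mod n < n" using n by simp
      have "(d + (t + n - d) mod n) mod n = (d + (t + n - d)) mod n" by (simp add: mod_add_right_eq)
      then show "t = (d + (t + n - d) mod n) mod n" using that u by (simp add: d_def)
    qed
    have "parity_check_matrix n u *\<^sub>v vec n (coeff c) = 0\<^sub>v n \<longleftrightarrow>
        (\<forall>k<n. (\<Sum>i<n. coeff (reflect_poly u) ((i + n - k) mod n) * coeff c i) = 0)"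
      by (auto simp: vec_eq_iff parity_check_matrix_def scalar_prod_def atLeast0LessThan)
    also have "\<dots> \<longleftrightarrow> (\<forall>t<n. coeff F t = 0)"
    proof (intro iffI allI impI)
      fix t assume *: "\<forall>k<n. (\<Sum>i<n. coeff (reflect_poly u) ((i + n - k) mod n) * coeff c i) = 0"
        and "t < n"
      then obtain k where "k < n" "t = (d + k) mod n" using surj by blast
      then show "coeff F t = 0" using * row by simp
    next
      fix k assume "\<forall>t<n. coeff F t = 0" "k < n"
      then show "(\<Sum>i<n. coeff (reflect_poly u) ((i + n - k) mod n) * coeff c i) = 0"
        using row n by simp
    qed
    also have "\<dots> \<longleftrightarrow> F = 0" using F0 by (auto simp: poly_eq_iff not_le[symmetric])
    also have "\<dots> \<longleftrightarrow> [F = 0] (mod xn1 n)"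
    proof
      assume "[F = 0] (mod xn1 n)"
      then have dv: "xn1 n dvd F" by (simp add: cong_0_iff)
      have "degree F \<le> n - 1" using F0 n by (intro degree_le) auto
      moreover have "degree (xn1 n :: 'a poly) \<ge> n"
        using n by (intro le_degree) (simp add: xn1_def)
      ultimately show "F = 0" using dvd_imp_degree_le[OF dv] n by fastforce
    qed simp
    also have "\<dots> \<longleftrightarrow> [c * u = 0] (mod xn1 n)"
      using mult_mod_cong[OF two n c u] unfolding F_def by (simp add: cong_def)
    finally show ?thesis .
  qed
  then show ?thesis unfolding cyclic_code_def by blast
qed

end

theory Submission
  imports Defs
begin

text \<open>
  A codeword vanishes at every \<open>n\<close>-th root of unity at which \<open>u\<close> does not. A run of ones in \<open>U\<close> is
  therefore a run of consecutive zeros of every codeword, and the lower bound is the BCH bound. The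
  upper bound holds because \<open>g\<close> and, by idempotency of \<open>u\<close>, also \<open>1 + u\<close> are nonzero codewords.
\<close>

section \<open>The BCH bound\<close>

lemma poly_eq_sum_support:
  fixes c :: "'a::comm_semiring_1 poly"
  shows "poly c x = (\<Sum>s\<in>{i. coeff c i \<noteq> 0}. coeff c s * x ^ s)"
proof -
  have "(\<Sum>s\<in>{i. coeff c i \<noteq> 0}. coeff c s * x ^ s) = (\<Sum>s\<le>degree c. coeff c s * x ^ s)"
    by (rule sum.mono_neutral_left) (auto intro: le_degree)
  then show ?thesis by (simp add: poly_altdef)
qed

lemma bch_bound:
  fixes c :: "'a::field poly"
  assumes inj: "inj_on (\<lambda>i. \<delta> ^ i) {..<n}" and \<delta>: "\<delta> \<noteq> 0"
    and c: "degree c < n" "c \<noteq> 0"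
    and zeros: "\<And>i. i < k \<Longrightarrow> poly c (\<delta> ^ (j + i)) = 0"
  shows "k < wt c"
proof (rule ccontr)
  assume "\<not> k < wt c"
  define S where "S = {i. coeff c i \<noteq> 0}"
  have S: "S \<subseteq> {..degree c}" by (auto simp: S_def intro: le_degree)
  then have fS: "finite S" by (rule finite_subset) simp
  have Sn: "S \<subseteq> {..<n}" using S c by auto
  have Sk: "card S \<le> k" using \<open>\<not> k < wt c\<close> by (simp add: wt_def S_def)
  \<comment> \<open>Any index in the support would do; the degree lies in it because
    \<open>c\<close> is nonzero.\<close>
  define t where "t = degree c"
  have t: "t \<in> S" using c by (simp add: S_def t_def)
  \<comment> \<open>The zeros of \<open>c\<close> say that a linear functional kills all polynomials of degree below \<open>k\<close>; testing
    it on \<open>p\<close> isolates one coefficient of \<open>c\<close>, which replaces the Vandermonde determinant.\<close>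
  define p where "p = (\<Prod>s\<in>S - {t}. [:- (\<delta> ^ s), 1:])"
  \<comment> \<open>Leaving \<open>t\<close> out of the product makes the degree one less than the
    weight, hence below \<open>k\<close>, so only the assumed zeros of \<open>c\<close> enter the
    sum below.\<close>
  have "degree p = card (S - {t})" unfolding p_def by (subst degree_prod_eq_sum_degree) auto
  also have "\<dots> < card S" using fS t by (intro psubset_card_mono) auto
  finally have dp: "degree p < k" using Sk by simp
  have "(\<Sum>s\<in>S. coeff c s * \<delta> ^ (s * j) * poly p (\<delta> ^ s))
      = (\<Sum>s\<in>S. \<Sum>i\<le>degree p. coeff p i * (coeff c s * \<delta> ^ (s * j) * \<delta> ^ (s * i)))"
    by (simp add: poly_altdef sum_distrib_left mult_ac flip: power_mult)
  also have "\<dots> = (\<Sum>i\<le>degree p. coeff p i * poly c (\<delta> ^ (j + i)))"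
    by (subst sum.swap)
       (simp add: poly_eq_sum_support S_def sum_distrib_left algebra_simps power_add flip: power_mult)
  also have "\<dots> = 0" using dp zeros by (intro sum.neutral) auto
  finally have "(\<Sum>s\<in>S. coeff c s * \<delta> ^ (s * j) * poly p (\<delta> ^ s)) = 0" .
  moreover have "poly p (\<delta> ^ s) = 0" if "s \<in> S - {t}" for s
    using that fS unfolding p_def poly_prod by (intro prod_zero) auto
  ultimately have "coeff c t * \<delta> ^ (t * j) * poly p (\<delta> ^ t) = 0"
    using fS t by (simp add: sum.remove)
  \<comment> \<open>Exponents in the support lie below \<open>n\<close>, where the powers of
    \<open>\<delta>\<close> are distinct, so \<open>\<delta> ^ t\<close> is not among the roots of
    \<open>p\<close>.\<close>
  moreover have "poly p (\<delta> ^ t) \<noteq> 0"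
    using fS t Sn inj by (auto simp: p_def poly_prod inj_on_def)
  ultimately show False using t \<delta> by (simp add: S_def)
qed

section \<open>Finite fields of even order\<close>

context
  fixes \<alpha> :: "'a::{field, finite}"
  assumes gen: "mult_generator \<alpha>"
begin

lemma mult_generator_nonzero: "\<alpha> \<noteq> 0"
proof
  assume "\<alpha> = 0"
  have "\<alpha> ^ 1 \<in> UNIV - {0}" using gen unfolding mult_generator_def by blast
  then show False using \<open>\<alpha> = 0\<close> by simp
qed

lemma mult_generator_cases:
  assumes "x \<noteq> 0"
  obtains k where "x = \<alpha> ^ k"
  using gen assms unfolding mult_generator_def by blast

text \<open>A collision gives \<open>\<alpha> ^ (j - i) = 1\<close>. Exponents then reduce modulo
  \<open>j - i\<close>, leaving too few powers to cover all nonzero elements.\<close>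

lemma mult_generator_inj: "inj_on (\<lambda>i. \<alpha> ^ i) {..<CARD('a) - 1}"
proof (rule linorder_inj_onI)
  fix i j :: nat
  assume ij: "i < j" "i \<in> {..<CARD('a) - 1}" "j \<in> {..<CARD('a) - 1}"
  show "\<alpha> ^ i \<noteq> \<alpha> ^ j"
  proof
    assume eq: "\<alpha> ^ i = \<alpha> ^ j"
    have "\<alpha> ^ i * \<alpha> ^ (j - i) = \<alpha> ^ (i + (j - i))" by (simp only: power_add)
    then have "\<alpha> ^ i * \<alpha> ^ (j - i) = \<alpha> ^ i * 1" using ij eq by simp
    then have one: "\<alpha> ^ (j - i) = 1" using mult_generator_nonzero by simp
    have "UNIV - {0} \<subseteq> (\<lambda>k. \<alpha> ^ k) ` {..<j - i}"
    proof
      fix x :: 'a assume "x \<in> UNIV - {0}"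
      then obtain k where k: "x = \<alpha> ^ k" by (auto elim: mult_generator_cases)
      have "\<alpha> ^ k = (\<alpha> ^ (j - i)) ^ (k div (j - i)) * \<alpha> ^ (k mod (j - i))"
        by (simp flip: power_mult power_add)
      then have "x = \<alpha> ^ (k mod (j - i))" using k one by simp
      then show "x \<in> (\<lambda>k. \<alpha> ^ k) ` {..<j - i}" using ij by auto
    qed
    then have "CARD('a) - 1 \<le> j - i"
      using surj_card_le[of "{..<j - i}" "UNIV - {0 :: 'a}"] by (simp add: card_Diff_singleton)
    then show False using ij by auto
  qed
qed auto

end

text \<open>Multiplication by a nonzero \<open>x\<close> permutes \<open>K - {0}\<close>; comparing
  the product of all elements before and after gives Fermat's identity.\<close>

lemma subfield_power_card:
  fixes K :: "'a::{field, finite} set"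
  assumes K: "is_subfield K" and x: "x \<in> K"
  shows "x ^ card K = x"
proof (cases "x = 0")
  case True
  have "card K > 0" using x by (auto simp: card_gt_0_iff)
  then show ?thesis using True by simp
next
  case False
  have "bij_betw ((*) x) (K - {0}) (K - {0})"
  proof (rule bij_betw_byWitness[where f' = "\<lambda>y. inverse x * y"])
    show "(*) x ` (K - {0}) \<subseteq> K - {0}" "(\<lambda>y. inverse x * y) ` (K - {0}) \<subseteq> K - {0}"
      using K x False unfolding is_subfield_def by auto
  qed (use False in auto)
  then have "\<Prod>(K - {0}) = (\<Prod>y\<in>K - {0}. x * y)"
    by (rule prod.reindex_bij_betw[symmetric])
  also have "\<dots> = x ^ card (K - {0}) * \<Prod>(K - {0})" by (simp add: prod.distrib)
  finally have "x ^ card (K - {0}) = 1" by simp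
  moreover have "card K = Suc (card (K - {0}))"
    using K unfolding is_subfield_def by (intro card.remove) auto
  ultimately show ?thesis by simp
qed

lemma is_subfield_UNIV: "is_subfield UNIV"
  by (simp add: is_subfield_def)

text \<open>All elements of \<open>K\<close> are roots of x^q - x with q = \<open>card K\<close>,
  and this polynomial has at most q roots. Membership in \<open>K\<close> thus becomes an equation
  that a Frobenius power can test.\<close>

lemma subfield_eq_fixed_points:
  fixes K :: "'a::{field, finite} set"
  assumes K: "is_subfield K"
  shows "K = {x. x ^ card K = x}"
proof (rule card_subset_eq)
  have "{0, 1} \<subseteq> K" using K by (simp add: is_subfield_def)
  then have "card {0, 1 :: 'a} \<le> card K" by (intro card_mono) auto
  \<comment> \<open>With q at least 2 the two monomials of \<open>p\<close> have different degrees,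
    so \<open>p\<close> is nonzero.\<close>
  then have K2: "card K \<ge> 2" by simp
  define p :: "'a poly" where "p = monom 1 (card K) - monom 1 1"
  have "coeff p (card K) = 1" using K2 by (simp add: p_def)
  then have "p \<noteq> 0" by auto
  moreover have "degree p \<le> card K"
    unfolding p_def using K2 by (intro degree_diff_le) (auto simp: degree_monom_eq)
  ultimately have "card {x. poly p x = 0} \<le> card K"
    using card_poly_roots_bound[of p] by linarith
  then have *: "card {x :: 'a. x ^ card K = x} \<le> card K" by (simp add: p_def poly_monom)
  show sub: "K \<subseteq> {x. x ^ card K = x}" using subfield_power_card[OF K] by blast
  show "card K = card {x :: 'a. x ^ card K = x}" using * card_mono[OF _ sub] by auto
qed auto

text \<open>Fermat's identity at -1 gives -1, while the even exponent gives 1.\<close>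

lemma char_2_of_even_card:
  assumes "CARD('a::{field, finite}) = 2 ^ k" "k > 0"
  shows "(1::'a) + 1 = 0"
proof -
  have "(-1 :: 'a) ^ 2 ^ k = -1"
    using subfield_power_card[OF is_subfield_UNIV, of "-1 :: 'a"] assms by simp
  moreover have "(-1 :: 'a) ^ 2 ^ k = 1" using assms by simp
  ultimately have "(1::'a) = -1" by simp
  then show ?thesis by (metis add.right_inverse)
qed

lemma char_2_add_self:
  assumes "(1::'a::ring_1) + 1 = 0"
  shows "x + x = (0::'a)"
  using assms by (metis distrib_left mult.right_neutral mult_zero_right)

lemma char_2_square_add:
  assumes "(1::'a::comm_ring_1) + 1 = 0"
  shows "(x + y)\<^sup>2 = x\<^sup>2 + (y::'a)\<^sup>2"
proof -
  have "(x + y)\<^sup>2 = x\<^sup>2 + y\<^sup>2 + (x * y + x * y)" by (simp add: power2_eq_square algebra_simps)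
  then show ?thesis using char_2_add_self[OF assms] by simp
qed

text \<open>Iterated squaring. For \<open>2 ^ k = card K\<close> this is the additivity of the map
  whose fixed points are \<open>K\<close>.\<close>

lemma char_2_power_add:
  assumes "(1::'a::comm_ring_1) + 1 = 0"
  shows "(x + y) ^ 2 ^ k = x ^ 2 ^ k + (y::'a) ^ 2 ^ k"
  by (induction k) (simp_all add: power_mult mult.commute[of 2] char_2_square_add[OF assms])

lemma char_2_square_sum:
  assumes "(1::'a::comm_ring_1) + 1 = 0"
  shows "(\<Sum>s\<in>M. f s)\<^sup>2 = (\<Sum>s\<in>M. (f s :: 'a)\<^sup>2)"
  by (induction M rule: infinite_finite_induct) (simp_all add: char_2_square_add[OF assms])

lemma char_2_poly:
  assumes "(1::'a::comm_ring_1) + 1 = 0"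
  shows "(1::'a poly) + 1 = 0"
  using assms by (simp add: one_pCons)

section \<open>The polynomial $1 + x^n$\<close>

lemma poly_xn1: "poly (xn1 n) x = 1 + x ^ n"
  by (simp add: xn1_def poly_monom)

lemma degree_xn1: "n > 0 \<Longrightarrow> degree (xn1 n :: 'a::field poly) = n"
  unfolding xn1_def by (subst degree_add_eq_right) (simp_all add: degree_monom_eq)

lemma monic_xn1: "n > 0 \<Longrightarrow> lead_coeff (xn1 n :: 'a::field poly) = 1"
  by (simp add: degree_xn1) (simp add: xn1_def)

lemma xn1_nonzero: "n > 0 \<Longrightarrow> (xn1 n :: 'a::field poly) \<noteq> 0"
  by (metis leading_coeff_0_iff monic_xn1 zero_neq_one)

text \<open>A double root is a root of the derivative n x^(n-1), which is x^(n-1) for odd n in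
  characteristic 2. Only 0 could be such a root, but 1 + x^n is 1 there.\<close>

lemma xn1_square_free:
  fixes a :: "'a::field"
  assumes two: "(1::'a) + 1 = 0" and n: "odd n"
  shows "\<not> [:- a, 1:]\<^sup>2 dvd xn1 n"
proof
  assume "[:- a, 1:]\<^sup>2 dvd xn1 n"
  then obtain q where q: "xn1 n = [:- a, 1:] * ([:- a, 1:] * q)"
    unfolding power2_eq_square dvd_def mult.assoc by blast
  have "poly (pderiv (xn1 n)) a = 0" by (simp add: q pderiv_mult del: mult_pCons_left)
  moreover have "pderiv (xn1 n) = monom (of_nat n) (n - 1)"
    by (simp add: xn1_def pderiv_add pderiv_monom)
  moreover have "of_nat n = (1::'a)"
    using n two by (elim oddE) (simp add: mult_2 char_2_add_self)
  ultimately have "poly (monom 1 (n - 1)) a = 0" by metis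
  then have "a ^ (n - 1) = 0" by (simp add: poly_monom)
  then have "a = 0" "n \<noteq> 1" by auto
  moreover have "poly (xn1 n) a = 0" by (simp add: q)
  ultimately show False using n by (auto simp: poly_xn1 power_0_left split: if_splits)
qed

text \<open>Comparing degrees, the multiset of linear factors has size \<open>n\<close>;
  square-freeness excludes repetitions, so its support also has \<open>n\<close> elements.\<close>

lemma card_roots_xn1:
  assumes two: "(1::'a::field) + 1 = 0" and n: "odd n" and split: "splits_in UNIV (xn1 n :: 'a poly)"
  shows "card {x::'a. x ^ n = 1} = n"
proof -
  have n0: "n > 0" using n by (rule odd_pos)
  obtain c A where cA: "(xn1 n :: 'a poly) = smult c (\<Prod>a\<in>#A. [:- a, 1:])"
    using split unfolding splits_in_def by blast
  have c0: "c \<noteq> 0" using cA xn1_nonzero[OF n0, where 'a = 'a] by auto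
  have "count A a \<le> 1" for a
  proof (rule ccontr)
    assume "\<not> count A a \<le> 1"
    then have "replicate_mset 2 a \<subseteq># A" by (simp flip: count_le_replicate_mset_subset_eq)
    then have "(\<Prod>a\<in>#replicate_mset 2 a. [:- a, 1:]) dvd (\<Prod>a\<in>#A. [:- a, 1:])"
      by (intro prod_mset_subset_imp_dvd image_mset_subseteq_mono)
    then have "[:- a, 1:]\<^sup>2 dvd xn1 n" by (simp add: cA dvd_smult)
    then show False using xn1_square_free[OF two n] by blast
  qed
  then have "A = mset_set (set_mset A)"
    by (intro multiset_eqI) (metis One_nat_def count_mset_set(1,3) finite_set_mset le_Suc_eq le_zero_eq not_in_iff)
  then have "card (set_mset A) = size A" by (metis size_mset_set)
  also have "size A = n"
  proof -
    have "degree (\<Prod>a\<in>#A. [:- a, 1:]) = size A"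
    proof (induction A)
      case (add x A)
      have "(\<Prod>a\<in>#A. [:- a, 1:]) \<noteq> 0" by (auto simp: prod_mset_zero_iff)
      then show ?case using add by (simp add: degree_mult_eq del: mult_pCons_left)
    qed simp
    then show ?thesis using degree_xn1[OF n0, where 'a = 'a] c0 by (simp add: cA)
  qed
  also have "set_mset A = {x. x ^ n = 1}"
  proof -
    have "poly (xn1 n) x = 0 \<longleftrightarrow> x \<in># A" for x :: 'a
      using c0 by (simp add: cA poly_prod_mset prod_mset_zero_iff) auto
    moreover have "poly (xn1 n) x = 0 \<longleftrightarrow> x ^ n = 1" for x :: 'a
      using two by (metis add_left_cancel poly_xn1)
    ultimately show ?thesis by auto
  qed
  finally show ?thesis .
qed

text \<open>Every n-th root of unity is also a (q-1)-th one, q being the field size, hence a d-th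
  one for d = gcd(n, q-1). There are \<open>n\<close> of them but at most d roots of x^d - 1, so d =
  n.\<close>

lemma splitting_exponent_dvd:
  assumes two: "(1::'a::{field, finite}) + 1 = 0" and n: "odd n"
    and split: "splits_in UNIV (xn1 n :: 'a poly)"
  shows "n dvd CARD('a) - 1"
proof -
  define d where "d = gcd n (CARD('a) - 1)"
  have d0: "d > 0" using n by (auto simp: d_def odd_pos)
  have "x ^ d = 1" if x: "x ^ n = 1" for x :: 'a
  proof -
    have n0: "n \<noteq> 0" using n by (auto simp: odd_pos)
    have "x \<noteq> 0" using x n0 by (auto simp: power_0_left)
    have "x * x ^ (CARD('a) - 1) = x ^ CARD('a)" by (simp flip: power_Suc)
    also have "\<dots> = x * 1" using subfield_power_card[OF is_subfield_UNIV, of x] by simp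
    finally have x1: "x ^ (CARD('a) - 1) = 1" using \<open>x \<noteq> 0\<close> by simp
    \<comment> \<open>Bezout's identity, arranged without subtraction for natural numbers.\<close>
    obtain a b where "n * a = (CARD('a) - 1) * b + d"
      using bezout_nat[OF n0, of "CARD('a) - 1"] unfolding d_def by blast
    then have "x ^ (n * a) = x ^ ((CARD('a) - 1) * b + d)" by (rule arg_cong)
    then have "(x ^ n) ^ a = (x ^ (CARD('a) - 1)) ^ b * x ^ d" by (simp only: power_add power_mult)
    then show ?thesis using x x1 by simp
  qed
  then have "{x::'a. x ^ n = 1} \<subseteq> {x. x ^ d = 1}" by blast
  then have "n \<le> card {x::'a. x ^ d = 1}"
    using card_mono card_roots_xn1[OF two n split] by (metis finite)
  also have "\<dots> \<le> d"
  proof -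
    define p :: "'a poly" where "p = monom 1 d - 1"
    have "coeff p d = 1" using d0 by (simp add: p_def)
    then have "p \<noteq> 0" by auto
    moreover have "degree p \<le> d"
      unfolding p_def by (intro degree_diff_le) (auto simp: degree_monom_eq)
    ultimately have "card {x. poly p x = 0} \<le> d"
      using card_poly_roots_bound[of p] by linarith
    then show ?thesis by (simp add: p_def poly_monom)
  qed
  finally have "n \<le> d" .
  moreover have "d dvd n" by (simp add: d_def)
  ultimately have "d = n" using n by (meson dvd_imp_le le_antisym odd_pos)
  then show ?thesis by (metis d_def gcd_dvd2)
qed

lemma cong_xn1_imp_poly_eq:
  assumes "[p = q] (mod xn1 n)" "poly (xn1 n) x = (0::'a::field)"
  shows "poly p x = poly q x"
proof -
  have "xn1 n dvd p - q" using assms(1) by (simp add: cong_iff_dvd_diff)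
  then obtain k where "p - q = xn1 n * k" by (elim dvdE)
  then have "poly (p - q) x = 0" using assms(2) by simp
  then show ?thesis by simp
qed

section \<open>Coefficients of the generator polynomial\<close>

lemma map_poly_mult_hom:
  fixes f :: "'a::comm_ring_1 \<Rightarrow> 'b::comm_ring_1"
  assumes f0: "f 0 = 0" and add: "\<And>x y. f (x + y) = f x + f y" and mult: "\<And>x y. f (x * y) = f x * f y"
  shows "map_poly f (p * q) = map_poly f p * map_poly f q"
proof (rule poly_eqI)
  fix k
  have "f (\<Sum>i\<in>I. g i) = (\<Sum>i\<in>I. f (g i))" for I :: "nat set" and g
    by (induction I rule: infinite_finite_induct) (simp_all add: f0 add)
  then show "coeff (map_poly f (p * q)) k = coeff (map_poly f p * map_poly f q) k"
    by (simp add: coeff_map_poly f0 coeff_mult mult)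
qed

lemma generator_poly_mult:
  fixes u :: "'a::field poly"
  assumes "n > 0"
  shows "generator_poly n u * monic_gcd u (xn1 n) = xn1 n"
proof -
  have "monic_gcd u (xn1 n) dvd xn1 n"
    using is_monic_gcd_monic_gcd[of u "xn1 n"] xn1_nonzero[OF assms] by (auto simp: is_monic_gcd_def)
  then show ?thesis by (simp add: generator_poly_def)
qed

text \<open>Raising coefficients to the power \<open>card K\<close> is a ring endomorphism fixing \<open>u\<close> and \<open>1 + x^n\<close>,
  hence their monic gcd and its cofactor.\<close>

lemma coeff_generator_poly_in_subfield:
  fixes K :: "'a::{field, finite} set"
  assumes two: "(1::'a) + 1 = 0" and K: "is_subfield K" "card K = 2 ^ k"
    and n: "n > 0" and u: "range (coeff u) \<subseteq> K"
  shows "range (coeff (generator_poly n u)) \<subseteq> K"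
proof -
  define h where "h = monic_gcd u (xn1 n)"
  define g where "g = generator_poly n u"
  define \<phi> where "\<phi> = (\<lambda>x::'a. x ^ 2 ^ k)"
  have K_fix: "x \<in> K \<longleftrightarrow> \<phi> x = x" for x
    using subfield_eq_fixed_points[OF K(1)] by (auto simp: K(2) \<phi>_def)
  have \<phi>_inj: "\<phi> 0 = 0" "\<phi> x = 0 \<longleftrightarrow> x = 0" for x by (auto simp: \<phi>_def)
  have hom: "map_poly \<phi> (p * q) = map_poly \<phi> p * map_poly \<phi> q" for p q
    by (rule map_poly_mult_hom) (simp_all add: \<phi>_def char_2_power_add[OF two] power_mult_distrib)
  have deg: "degree (map_poly \<phi> p) = degree p" for p
    by (cases "p = 0") (auto intro: map_poly_degree_eq simp: \<phi>_inj)
  have fix_iff: "map_poly \<phi> p = p \<longleftrightarrow> range (coeff p) \<subseteq> K" for p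
    by (auto simp: poly_eq_iff coeff_map_poly \<phi>_inj image_subset_iff simp flip: K_fix)
  have "range (coeff (xn1 n)) \<subseteq> K" using K(1) by (auto simp: xn1_def is_subfield_def)
  then have fx: "map_poly \<phi> (xn1 n) = xn1 n" by (simp add: fix_iff)
  have fu: "map_poly \<phi> u = u" using u by (simp add: fix_iff)
  have h: "is_monic_gcd h u (xn1 n)"
    unfolding h_def using xn1_nonzero[OF n] by (intro is_monic_gcd_monic_gcd) auto
  have dvd: "map_poly \<phi> h dvd p" if "h dvd p" "map_poly \<phi> p = p" for p
    using that hom by (metis dvd_def)
  \<comment> \<open>As \<open>u\<close> and 1 + x^n are fixed, the image of \<open>h\<close> is
    again a common divisor of them.\<close>
  have "map_poly \<phi> h dvd h"
    using h dvd fu fx unfolding is_monic_gcd_def by blast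
  then obtain q where q: "h = map_poly \<phi> h * q" by (elim dvdE)
  have l1: "lead_coeff h = 1" using h by (simp add: is_monic_gcd_def)
  then have l2: "lead_coeff (map_poly \<phi> h) = 1"
    by (simp only: deg coeff_map_poly \<phi>_inj) (simp add: \<phi>_def)
  have h0: "h \<noteq> 0" "map_poly \<phi> h \<noteq> 0" "q \<noteq> 0" using l1 l2 q by auto
  \<comment> \<open>The coefficient map keeps the degree and the leading coefficient 1, so the
    cofactor \<open>q\<close> is a monic constant.\<close>
  have "degree h = degree h + degree q"
    using q h0 by (metis deg degree_mult_eq)
  moreover have "lead_coeff h = lead_coeff q" using q l2 by (metis lead_coeff_mult mult_1)
  ultimately have "q = 1" using l1 by (auto elim!: degree_eq_zeroE)
  then have fh: "map_poly \<phi> h = h" using q by simp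
  have gh: "g * h = xn1 n" unfolding g_def h_def by (rule generator_poly_mult[OF n])
  have "map_poly \<phi> g * h = g * h" using hom[of g h] by (simp add: gh fx fh)
  then have "map_poly \<phi> g = g" using h0 by simp
  then show ?thesis by (simp add: fix_iff g_def)
qed

section \<open>Distances in a cyclic code\<close>

lemma min_dist_le_wt:
  assumes "c \<in> C" "0 \<in> C" "c \<noteq> 0"
  shows "min_dist C \<le> wt c"
proof -
  have "wt c = hamming_dist c 0" by (simp add: hamming_dist_def wt_def)
  then have "wt c \<in> {hamming_dist c c' |c c'. c \<in> C \<and> c' \<in> C \<and> c \<noteq> c'}" using assms by blast
  then show ?thesis unfolding min_dist_def by (intro cInf_lower) auto
qed

text \<open>A nonempty set of naturals attains its infimum, and a distance is the weight of a
  difference, which lies in \<open>C\<close> by closure.\<close>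

lemma min_dist_attained:
  fixes C :: "'a::ab_group_add poly set"
  assumes "0 \<in> C" "C \<noteq> {0}" "\<And>c c'. c \<in> C \<Longrightarrow> c' \<in> C \<Longrightarrow> c - c' \<in> C"
  obtains c where "c \<in> C" "c \<noteq> 0" "min_dist C = wt c"
proof -
  let ?D = "{hamming_dist c c' |c c'. c \<in> C \<and> c' \<in> C \<and> c \<noteq> c'}"
  have "?D \<noteq> {}" using assms by blast
  then have "min_dist C \<in> ?D" unfolding min_dist_def by (rule Inf_nat_def1)
  then obtain c c' where "c \<in> C" "c' \<in> C" "c \<noteq> c'" "min_dist C = hamming_dist c c'" by blast
  then show ?thesis using assms(3) by (intro that[of "c - c'"]) (auto simp: hamming_dist_def wt_def)
qed

section \<open>Polynomials over the subfield, and parity-check idempotents\<close>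

lemma T_add:
  assumes "is_subfield K" "p \<in> T K n" "q \<in> T K n"
  shows "p + q \<in> T K n"
  using assms by (auto simp: T_def is_subfield_def image_subset_iff intro: degree_add_le)

lemma T_diff:
  assumes "is_subfield K" "p \<in> T K n" "q \<in> T K n"
  shows "p - q \<in> T K n"
proof -
  have "- q \<in> T K n" using assms by (auto simp: T_def is_subfield_def)
  then show ?thesis using T_add[OF assms(1,2)] by (metis add_uminus_conv_diff)
qed

lemma T_0: "is_subfield K \<Longrightarrow> 0 \<in> T K n"
  by (auto simp: T_def is_subfield_def)

lemma T_1: "is_subfield K \<Longrightarrow> 1 \<in> T K n"
  by (auto simp: T_def is_subfield_def)

lemma parity_check_idempotent_in_T:
  assumes "is_subfield K" "parity_check_idempotent K m n \<beta> u"
  shows "u \<in> T K n"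
proof -
  obtain M e where "\<And>s. s \<in> M \<Longrightarrow> cyclotomic_idempotent K m n \<beta> s (e s)" "u = (\<Sum>s\<in>M. e s)"
    using assms unfolding parity_check_idempotent_def by blast
  moreover have "(\<Sum>s\<in>M. f s) \<in> T K n" if "\<And>s. s \<in> M \<Longrightarrow> f s \<in> T K n" for f
    using that by (induction M rule: infinite_finite_induct) (simp_all add: T_0 T_add assms(1))
  ultimately show ?thesis by (simp add: cyclotomic_idempotent_def)
qed

text \<open>In characteristic 2 the cross terms cancel, so the square of a sum of idempotents is the
  sum of their squares.\<close>

lemma parity_check_idempotent_idempotent:
  fixes u :: "'a::field poly"
  assumes two: "(1::'a) + 1 = 0" and "parity_check_idempotent K m n \<beta> u"
  shows "idempotent n u"
proof -
  obtain M e where "\<And>s. s \<in> M \<Longrightarrow> cyclotomic_idempotent K m n \<beta> s (e s)" "u = (\<Sum>s\<in>M. e s)"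
    using assms unfolding parity_check_idempotent_def by blast
  then show ?thesis
    unfolding idempotent_def
    by (simp add: char_2_square_sum[OF char_2_poly[OF two]])
       (intro cong_sum, simp add: cyclotomic_idempotent_def idempotent_def)
qed

lemma coeff_MS: "j < n \<Longrightarrow> coeff (MS \<alpha> r n a) j = poly a (inverse \<alpha> ^ (r * j))"
  by (simp add: MS_def coeff_sum)

lemma wt_one_add_le:
  fixes u :: "'a::comm_ring_1 poly"
  shows "wt (1 + u) \<le> 1 + wt u"
proof -
  have fin: "finite {i. coeff u i \<noteq> 0}"
    by (rule finite_subset[of _ "{..degree u}"]) (auto intro: le_degree)
  have "{i. coeff (1 + u) i \<noteq> 0} \<subseteq> insert 0 {i. coeff u i \<noteq> 0}" by (auto simp: coeff_1)
  then have "wt (1 + u) \<le> card (insert 0 {i. coeff u i \<noteq> 0})"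
    unfolding wt_def using fin by (intro card_mono) auto
  also have "\<dots> \<le> 1 + wt u" unfolding wt_def using card_insert_le_m1 fin by (simp add: card_insert_if)
  finally show ?thesis .
qed

theorem mainTheorem1:
  fixes m m' n r l d_0 d_min :: nat
    and K :: "'a::{field, finite} set"
    and \<alpha> \<beta> :: 'a
    and u U g :: "'a poly"
    and C :: "'a poly set"
  assumes "m \<ge> 2" and "m' > 0" and "m dvd m'" and "odd n"
    and "CARD('a) = 2 ^ m'"
    and "is_subfield K" and "card K = 2 ^ m"
    and "type_is_splitting_field K (xn1 n)"
    and "r = (2 ^ m' - 1) div n" and "l = (2 ^ m' - 1) div (2 ^ m - 1)"
    and "mult_generator \<alpha>" and "\<beta> = \<alpha> ^ l"
    and "parity_check_idempotent K m n \<beta> u"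
    and "C = cyclic_code K n u" and "C \<noteq> {0}"
    and "g = generator_poly n u"
    and "d_min = min_dist C"
    and "U = MS \<alpha> r n u"
    and "d_0 = max_cyclic_run n U"
  shows "d_0 < d_min \<and> d_min \<le> min (wt g) (1 + wt u)"
proof -
  have n: "n > 0" using \<open>odd n\<close> by (rule odd_pos)
  have two: "(1::'a) + 1 = 0" using char_2_of_even_card assms(2,5) by blast
  have uT: "u \<in> T K n" using parity_check_idempotent_in_T assms by blast
  have idem: "idempotent n u" using parity_check_idempotent_idempotent[OF two] assms by blast
  have degT: "degree c < n" if "c \<in> T K n" for c using that n by (auto simp: T_def)
  have C_iff: "c \<in> C \<longleftrightarrow> c \<in> T K n \<and> [c * u = 0] (mod xn1 n)" for c
    using cyclic_code_eq[OF two n degT[OF uT], of K] assms(14) by simp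
  have C0: "0 \<in> C" using T_0 assms(6) by (auto simp: C_iff)
  have Cdiff: "c - c' \<in> C" if "c \<in> C" "c' \<in> C" for c c'
    using that T_diff[OF assms(6)] by (auto simp: C_iff cong_0_iff left_diff_distrib)

  \<comment> \<open>A primitive n-th root of unity\<close>
  have "n dvd 2 ^ m' - 1"
    using splitting_exponent_dvd[OF two \<open>odd n\<close>] assms(5,8) by (simp add: type_is_splitting_field_def)
  then have rn: "r * n = CARD('a) - 1" using assms(5,9) by simp
  have "CARD('a) > 1" unfolding assms(5) using \<open>m' > 0\<close> by (intro one_less_power) auto
  then have "r > 0" using rn by (cases r) auto
  \<comment> \<open>Chosen so that the coefficient of \<open>U\<close> at position \<open>i\<close>
    is the value of \<open>u\<close> at \<open>\<delta> ^ i\<close>.\<close>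
  define \<delta> where "\<delta> = inverse \<alpha> ^ r"
  have \<alpha>0: "\<alpha> \<noteq> 0" using mult_generator_nonzero assms(11) by blast
  then have \<delta>0: "\<delta> \<noteq> 0" by (simp add: \<delta>_def)
  have \<delta>_inj: "inj_on (\<lambda>i. \<delta> ^ i) {..<n}"
  proof (rule inj_onI)
    fix s t assume st: "s \<in> {..<n}" "t \<in> {..<n}" "\<delta> ^ s = \<delta> ^ t"
    have "\<alpha> ^ (r * s) = \<alpha> ^ (r * t)"
      using st(3) by (simp add: \<delta>_def power_inverse flip: power_mult)
    \<comment> \<open>Since \<open>r * n\<close> is exactly the group order, these exponents stay in
      the range where powers of \<open>\<alpha>\<close> are distinct.\<close>
    moreover have "r * s < CARD('a) - 1" "r * t < CARD('a) - 1"
      unfolding rn[symmetric] using st \<open>r > 0\<close> by simp_all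
    ultimately have "r * s = r * t"
      using mult_generator_inj[OF assms(11)] by (auto dest: inj_onD)
    then show "s = t" using \<open>r > 0\<close> by simp
  qed
  have \<delta>n: "\<delta> ^ n = 1"
  proof -
    have "\<alpha> * \<alpha> ^ (CARD('a) - 1) = \<alpha> ^ CARD('a)" by (simp flip: power_Suc)
    also have "\<dots> = \<alpha> * 1" using subfield_power_card[OF is_subfield_UNIV, of \<alpha>] by simp
    finally have "\<alpha> ^ (r * n) = 1" using \<alpha>0 by (simp add: rn)
    then show ?thesis by (simp add: \<delta>_def power_inverse flip: power_mult)
  qed
  have root: "poly (xn1 n) (\<delta> ^ i) = 0" for i
  proof -
    have "(\<delta> ^ i) ^ n = (\<delta> ^ n) ^ i" by (simp add: mult.commute flip: power_mult)
    then show ?thesis using two by (simp add: poly_xn1 \<delta>n del: one_add_one)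
  qed
  have word: "poly c (\<delta> ^ i) * poly u (\<delta> ^ i) = 0" if "c \<in> C" for c i
    using cong_xn1_imp_poly_eq[OF _ root, of "c * u" 0] that by (simp add: C_iff)

  \<comment> \<open>Otherwise every codeword would vanish at all \<open>n\<close> powers of
    \<open>\<delta>\<close>, and the BCH bound would give a nonzero one weight above
    \<open>n\<close>. The zero of \<open>u\<close> found here serves both upper bounds.\<close>
  have "\<exists>i<n. poly u (\<delta> ^ i) = 0"
  proof (rule ccontr)
    assume no: "\<not> ?thesis"
    obtain c where c: "c \<in> C" "c \<noteq> 0" using C0 \<open>C \<noteq> {0}\<close> by blast
    have "n < wt c"
      using \<delta>_inj \<delta>0 degT c word[OF c(1)] no by (intro bch_bound[where j = 0]) (auto simp: C_iff)
    moreover have "wt c \<le> card {..<n}"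
      unfolding wt_def using c(1) degT[of c] le_degree[of c]
      by (intro card_mono) (auto simp: C_iff intro: le_less_trans)
    ultimately show False by simp
  qed
  then obtain i where i: "poly u (\<delta> ^ i) = 0" by blast

  have "d_0 < d_min"
  proof -
    let ?R = "{k. k \<le> n \<and> (\<exists>j<n. \<forall>i<k. coeff U ((j + i) mod n) = 1)}"
    have "finite ?R" by (rule finite_subset[of _ "{..n}"]) auto
    \<comment> \<open>The empty run keeps the maximum well defined even when no coefficient of
      \<open>U\<close> is 1.\<close>
    moreover have "0 \<in> ?R" using n by auto
    ultimately have "Max ?R \<in> ?R" by (intro Max_in) blast+
    then have "d_0 \<in> ?R" using assms(19) unfolding max_cyclic_run_def by simp
    then obtain j where run: "\<And>i. i < d_0 \<Longrightarrow> coeff U ((j + i) mod n) = 1" by blast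
    have "poly u (\<delta> ^ (j + i)) = 1" if "i < d_0" for i
    proof -
      \<comment> \<open>Because \<open>\<delta> ^ n = 1\<close>, a run that wraps around modulo
        \<open>n\<close> still gives consecutive powers of \<open>\<delta>\<close>.\<close>
      have "\<delta> ^ (j + i) = (\<delta> ^ n) ^ ((j + i) div n) * \<delta> ^ ((j + i) mod n)"
        by (simp flip: power_mult power_add)
      then have "\<delta> ^ (j + i) = \<delta> ^ ((j + i) mod n)" by (simp add: \<delta>n)
      then show ?thesis
        using run[OF that] n by (simp add: assms(18) coeff_MS \<delta>_def flip: power_mult)
    qed
    then have zeros: "poly c (\<delta> ^ (j + i)) = 0" if "c \<in> C" "i < d_0" for c i
      using word[OF that(1), of "j + i"] that(2) by simp
    obtain c where c: "c \<in> C" "c \<noteq> 0" "min_dist C = wt c"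
      using min_dist_attained[OF C0 \<open>C \<noteq> {0}\<close> Cdiff] by blast
    then have "degree c < n" using degT by (simp add: C_iff)
    then have "d_0 < wt c" using bch_bound[OF \<delta>_inj \<delta>0] zeros[OF c(1)] c(2) by blast
    then show ?thesis using c(3) assms(17) by simp
  qed
  moreover have "d_min \<le> wt g"
  proof -
    define h where "h = monic_gcd u (xn1 n)"
    have gh: "g * h = xn1 n" unfolding h_def assms(16) by (rule generator_poly_mult[OF n])
    then have gh0: "g \<noteq> 0" "h \<noteq> 0" using xn1_nonzero[OF n, where 'a = 'a] by auto
    have h: "is_monic_gcd h u (xn1 n)"
      unfolding h_def using xn1_nonzero[OF n] by (intro is_monic_gcd_monic_gcd) auto
    \<comment> \<open>The common root makes \<open>h\<close> nonconstant, so the degree of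
      \<open>g\<close> drops below \<open>n\<close>, as a codeword requires.\<close>
    have "[:- (\<delta> ^ i), 1:] dvd h"
      using h i root unfolding is_monic_gcd_def by (metis poly_eq_0_iff_dvd)
    then have "degree h \<ge> 1" using gh0 dvd_imp_degree_le by fastforce
    moreover have "degree g + degree h = n"
      using gh gh0 degree_mult_eq degree_xn1[OF n] by metis
    ultimately have "g \<in> T K n"
      using coeff_generator_poly_in_subfield[OF two assms(6,7) n] uT by (auto simp: T_def assms(16))
    \<comment> \<open>Since \<open>h\<close> divides \<open>u\<close>, the product
      \<open>g * h\<close>, which is 1 + x^n, divides \<open>g * u\<close>.\<close>
    moreover have "xn1 n dvd g * u"
      using h unfolding gh[symmetric] is_monic_gcd_def by (intro mult_dvd_mono) auto
    ultimately have "g \<in> C" by (simp add: C_iff cong_0_iff)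
    then show ?thesis using min_dist_le_wt C0 gh0 assms(17) by blast
  qed
  moreover have "d_min \<le> 1 + wt u"
  proof -
    \<comment> \<open>Idempotency replaces the square of \<open>u\<close> by \<open>u\<close>;
      characteristic 2 then cancels the two copies.\<close>
    have "[(1 + u) * u = u + u] (mod xn1 n)"
      using cong_add[OF cong_refl idem[unfolded idempotent_def], of u]
      by (simp add: distrib_right power2_eq_square)
    also have "u + u = 0" by (rule char_2_add_self[OF char_2_poly[OF two]])
    finally have "1 + u \<in> C"
      using T_add[OF assms(6) T_1[OF assms(6)] uT] by (simp add: C_iff)
    \<comment> \<open>Otherwise \<open>u\<close> would be the constant 1, contradicting its zero at
      \<open>\<delta> ^ i\<close>.\<close>
    moreover have "1 + u \<noteq> 0"
    proof
      assume "1 + u = 0"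
      then have "u = 1" using char_2_poly[OF two] by (metis add_left_cancel)
      then show False using i by simp
    qed
    ultimately show ?thesis
      using min_dist_le_wt[OF _ C0] wt_one_add_le[of u] assms(17) by fastforce
  qed
  ultimately show ?thesis by simp
qed

end
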